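(* Let $\mathcal H = (H, \preceq)$ be a weakly l.f.g.u. weakly positive monoid such that every $\preceq$-irreducible is a $\preceq$-atom. Then $\mathcal H$ is loft and hence FmF-atomic.
   Context: A premonoid is a pair $\mathcal H = (H, \preceq)$ consisting of a (multiplicatively written) monoid $H$ with identity $1_H$ and a preorder (reflexive, transitive relation) $\preceq$ on $H$. Write $x \prec y$ if $x \preceq y$ and $y \not\preceq x$. An element $u \in H$ is a $\preceq$-unit if $u \preceq 1_H \preceq u$ and a $\preceq$-non-unit otherwise; $\mathcal H^\times$ is the set of $\preceq$-units. A $\preceq$-atom is a $\preceq$-non-unit that is not a product of two $\preceq$-non-units. A $\preceq$-irreducible is a $\preceq$-non-unit $a$ such that $a \neq xy$ for all $\preceq$-non-units $x, y$ with $x \prec a$ and $y \prec a$. $\mathscr A(\mathcal H)$ and $\mathscr I(\mathcal H)$ are the sets of $\preceq$-atoms and $\preceq$-irreducibles. $\mathcal H$ is a weakly positive monoid if, for every $x \in H$, one has $uxv \preceq x$ for all $u, v \in \mathcal H^\times$ and $x \preceq yxz$ for all $y, z \in H$. A subpremonoid of $\mathcal H$ is a premonoid $(K,\preceq_K)$ with $K$ a submonoid of $H$ and $\preceq_K$ the restriction of $\preceq$ to $K$. A divisor of $x$ in $H$ is an element $y \in H$ with $x \in HyH$. The germ of $\mathcal H$ at $x \in H$ is the subpremonoid of $\mathcal H$ whose underlying monoid is the submonoid of $H$ generated by all divisors of $x$ in $H$. A premonoid $\mathcal K = (K, \preceq_K)$ is f.g.u. if $K$ is generated as a monoid by $\mathcal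 K^\times A\, \mathcal K^\times$ for some finite $A \subseteq K$, where $\mathcal K^\times$ is the set of $\preceq_K$-units. $\mathcal H$ is weakly l.f.g.u. if its germ at every $\preceq$-non-unit is f.g.u. For a set $X$, an $X$-word is an element of the free monoid $\mathscr F(X)$, i.e., a finite (possibly empty) tuple of elements of $X$; $\|\mathfrak a\|$ is the length of $\mathfrak a$ and $\mathfrak a[i]$ its $i$-th letter. Let $\pi_H \colon \mathscr F(H) \to H$ be the product-of-letters homomorphism. Define a preorder on $\mathscr F(H)$ by: $\mathfrak a \sqsubseteq_{\mathcal H} \mathfrak b$ iff there is an injective $\sigma \colon \{1, \ldots, \|\mathfrak a\|\} \to \{1, \ldots, \|\mathfrak b\|\}$ with $\mathfrak a[i] \preceq \mathfrak b[\sigma(i)] \preceq \mathfrak a[i]$ for every $i$. Words are $\sqsubseteq_{\mathcal H}$-equivalent if each is $\sqsubseteq_{\mathcal H}$ the other; $\mathfrak a \sqsubset_{\mathcal H} \mathfrak b$ means $\mathfrak a \sqsubseteq_{\mathcal H} \mathfrak b$ and not $\mathfrak b \sqsubseteq_{\mathcal H} \mathfrak a$. A $\preceq$-factorization of $x \in H$ is a word $\mathfrak a \in \mathscr F(\mathscr I(\mathcal H))$ with $\pi_H(\mathfrak a) = x$; it is minimal if there is no $\preceq$-factorization $\mathfrak b$ of $x$ with $\mathfrak b \sqsubset_{\mathcal H} \mathfrak a$. A minimal atomic $\preceq$-factorization of $x$ is a minimal $\preceq$-factorization of $x$ that is an $\mathscr A(\mathcal H)$-word. $\mathcal H$ is loft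 if, for each $\preceq$-non-unit $x$, there is a finite set $A_x \subseteq \mathscr I(\mathcal H)$ such that every $\preceq$-factorization of $x$ is $\sqsubseteq_{\mathcal H}$-equivalent to an $A_x$-word. $\mathcal H$ is FmF-atomic if, for every $\preceq$-non-unit $x$, the set of minimal atomic $\preceq$-factorizations of $x$ is non-empty and has finitely many classes under $\sqsubseteq_{\mathcal H}$-equivalence. *)

theory Defs
  imports "HOL.Hull" "HOL-Algebra.Coset"
begin

text \<open>Only the values of the relation on the carrier matter.  Hence, in the usual style of
  HOL-Algebra, the subpremonoid of \<open>H\<close> on a submonoid \<open>K\<close> is \<open>H\<lparr>carrier := K\<rparr>\<close>.\<close>

record 'a premonoid = "'a monoid" +
  preord :: "'a \<Rightarrow> 'a \<Rightarrow> bool" (infix "\<preceq>\<index>" 50)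

locale premonoid = monoid H for H (structure) +
  assumes preord_refl: "reflp_on (carrier H) (\<preceq>)"
    and preord_trans: "transp_on (carrier H) (\<preceq>)"

definition strict_preord :: "('a, 'b) premonoid_scheme \<Rightarrow> 'a \<Rightarrow> 'a \<Rightarrow> bool" (infix "\<prec>\<index>" 50)
  where "x \<prec>\<^bsub>H\<^esub> y \<longleftrightarrow> x \<preceq>\<^bsub>H\<^esub> y \<and> \<not> y \<preceq>\<^bsub>H\<^esub> x"

definition punits :: "('a, 'b) premonoid_scheme \<Rightarrow> 'a set"
  where "punits H = {u \<in> carrier H. u \<preceq>\<^bsub>H\<^esub> \<one>\<^bsub>H\<^esub> \<and> \<one>\<^bsub>H\<^esub> \<preceq>\<^bsub>H\<^esub> u}"

definition pnonunits :: "('a, 'b) premonoid_scheme \<Rightarrow> 'a set"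
  where "pnonunits H = carrier H - punits H"

definition patoms :: "('a, 'b) premonoid_scheme \<Rightarrow> 'a set"
  where "patoms H =
    {a \<in> pnonunits H. \<not> (\<exists>x \<in> pnonunits H. \<exists>y \<in> pnonunits H. a = x \<otimes>\<^bsub>H\<^esub> y)}"

definition pirreducibles :: "('a, 'b) premonoid_scheme \<Rightarrow> 'a set"
  where "pirreducibles H =
    {a \<in> pnonunits H. \<forall>x \<in> pnonunits H. \<forall>y \<in> pnonunits H.
       x \<prec>\<^bsub>H\<^esub> a \<and> y \<prec>\<^bsub>H\<^esub> a \<longrightarrow> a \<noteq> x \<otimes>\<^bsub>H\<^esub> y}"

locale weakly_positive_monoid = premonoid +
  assumes unit_mult_le:
      "\<lbrakk>x \<in> carrier H; u \<in> punits H; v \<in> punits H\<rbrakk> \<Longrightarrow> u \<otimes> x \<otimes> v \<preceq> x"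
    and le_mult:
      "\<lbrakk>x \<in> carrier H; y \<in> carrier H; z \<in> carrier H\<rbrakk> \<Longrightarrow> x \<preceq> y \<otimes> x \<otimes> z"


subsection \<open>Germs\<close>

definition generated_submonoid :: "('a, 'b) monoid_scheme \<Rightarrow> 'a set \<Rightarrow> 'a set"
  where "generated_submonoid G S = (\<lambda>K. submonoid K G) hull S"

text \<open>Two-sided divisors: \<open>y\<close> divides \<open>x\<close> if \<open>x \<in> HyH\<close>.\<close>

definition divisors :: "('a, 'b) monoid_scheme \<Rightarrow> 'a \<Rightarrow> 'a set"
  where "divisors H x =
    {y \<in> carrier H. \<exists>u \<in> carrier H. \<exists>v \<in> carrier H. x = u \<otimes>\<^bsub>H\<^esub> y \<otimes>\<^bsub>H\<^esub> v}"

definition germ :: "('a, 'b) premonoid_scheme \<Rightarrow> 'a \<Rightarrow> ('a, 'b) premonoid_scheme"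
  where "germ H x = H\<lparr>carrier := generated_submonoid H (divisors H x)\<rparr>"

definition fgu :: "('a, 'b) premonoid_scheme \<Rightarrow> bool"
  where "fgu K \<longleftrightarrow> (\<exists>A. finite A \<and> A \<subseteq> carrier K \<and>
    generated_submonoid K (punits K <#>\<^bsub>K\<^esub> A <#>\<^bsub>K\<^esub> punits K) = carrier K)"

definition weakly_lfgu :: "('a, 'b) premonoid_scheme \<Rightarrow> bool"
  where "weakly_lfgu H \<longleftrightarrow> (\<forall>x \<in> pnonunits H. fgu (germ H x))"

lemma (in monoid) submonoid_generated_submonoid:
  assumes "S \<subseteq> carrier G"
  shows "submonoid (generated_submonoid G S) G"
  using assms monoid_axioms
  by (auto simp: generated_submonoid_def hull_def submonoid_def)

lemma (in premonoid) premonoid_germ: "premonoid (germ H x)"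
proof -
  have sub: "submonoid (generated_submonoid H (divisors H x)) H"
    by (rule submonoid_generated_submonoid) (auto simp: divisors_def)
  note le = submonoid.subset[OF sub]
  show ?thesis
    using submonoid.submonoid_is_monoid[OF sub monoid_axioms]
      reflp_on_subset[OF preord_refl le] transp_on_subset[OF preord_trans le]
    by (simp add: premonoid_def premonoid_axioms_def germ_def)
qed


subsection \<open>Words and factorizations\<close>

text \<open>An \<open>X\<close>-word is an element of \<^term>\<open>lists X\<close>; letters are indexed from 0.\<close>

definition word_prod :: "('a, 'b) monoid_scheme \<Rightarrow> 'a list \<Rightarrow> 'a"
  where "word_prod H as = foldr (\<otimes>\<^bsub>H\<^esub>) as \<one>\<^bsub>H\<^esub>"

definition word_le :: "('a, 'b) premonoid_scheme \<Rightarrow> 'a list \<Rightarrow> 'a list \<Rightarrow> bool"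
  where "word_le H as bs \<longleftrightarrow>
    (\<exists>\<sigma>. \<sigma> \<in> {..<length as} \<rightarrow> {..<length bs} \<and> inj_on \<sigma> {..<length as} \<and>
       (\<forall>i<length as. as ! i \<preceq>\<^bsub>H\<^esub> bs ! \<sigma> i \<and> bs ! \<sigma> i \<preceq>\<^bsub>H\<^esub> as ! i))"

definition word_less :: "('a, 'b) premonoid_scheme \<Rightarrow> 'a list \<Rightarrow> 'a list \<Rightarrow> bool"
  where "word_less H as bs \<longleftrightarrow> word_le H as bs \<and> \<not> word_le H bs as"

definition word_equiv :: "('a, 'b) premonoid_scheme \<Rightarrow> 'a list \<Rightarrow> 'a list \<Rightarrow> bool"
  where "word_equiv H as bs \<longleftrightarrow> word_le H as bs \<and> word_le H bs as"

definition factorizations :: "('a, 'b) premonoid_scheme \<Rightarrow> 'a \<Rightarrow> 'a list set"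
  where "factorizations H x = {as \<in> lists (pirreducibles H). word_prod H as = x}"

definition min_factorizations :: "('a, 'b) premonoid_scheme \<Rightarrow> 'a \<Rightarrow> 'a list set"
  where "min_factorizations H x =
    {as \<in> factorizations H x. \<not> (\<exists>bs \<in> factorizations H x. word_less H bs as)}"

definition min_atomic_factorizations :: "('a, 'b) premonoid_scheme \<Rightarrow> 'a \<Rightarrow> 'a list set"
  where "min_atomic_factorizations H x = min_factorizations H x \<inter> lists (patoms H)"

definition loft :: "('a, 'b) premonoid_scheme \<Rightarrow> bool"
  where "loft H \<longleftrightarrow> (\<forall>x \<in> pnonunits H. \<exists>A. finite A \<and> A \<subseteq> pirreducibles H \<and>
    (\<forall>as \<in> factorizations H x. \<exists>bs \<in> lists A. word_equiv H as bs))"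

definition FmF_atomic :: "('a, 'b) premonoid_scheme \<Rightarrow> bool"
  where "FmF_atomic H \<longleftrightarrow> (\<forall>x \<in> pnonunits H.
    let Z = min_atomic_factorizations H x
    in Z \<noteq> {} \<and> finite (Z // {(as, bs) \<in> Z \<times> Z. word_equiv H as bs}))"

end

theory Submission
  imports Defs HOL.Topological_Spaces "HOL-Combinatorics.List_Permutation"
begin

text \<open>Each divisor \<open>y\<close> of a non-unit \<open>x\<close> lies in the germ at \<open>x\<close>, so it is a product of finitely
  many elements \<open>uav\<close> with \<open>u, v\<close> units and \<open>a\<close> in a fixed finite set \<open>A\<close>; a non-unit \<open>y\<close>
  can absorb the units among these factors into the neighbouring ones. If \<open>y\<close> is an atom, only one
  factor remains, so \<open>y\<close> is equivalent to \<open>a\<close>, which is again an atom: hence the loft property.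
  Up to equivalence the factors \<open>uav\<close> take finitely many values, and every factor precedes the
  product, so splitting a reducible factor over and over terminates; this gives a factorization, and
  a shortest one is minimal. Finally, minimal factorizations are pairwise
  incomparable or equivalent, so by Dickson's lemma over a finite alphabet they form finitely many
  classes.\<close>

section \<open>Dickson's lemma for multisets\<close>

text \<open>Every sequence has a monotone subsequence, and a decreasing sequence of natural numbers
  is eventually constant; so passing to a tail makes it non-decreasing in either case.\<close>

lemma nat_seq_mono_subseq:
  fixes s :: "nat \<Rightarrow> nat"
  obtains r :: "nat \<Rightarrow> nat" where "strict_mono r" "mono (s \<circ> r)"
proof -
  obtain f where f: "strict_mono f" "monoseq (\<lambda>n. s (f n))"
    using seq_monosub[of s] by blast
  show ?thesis
  proof (cases "\<forall>m n. m \<le> n \<longrightarrow> s (f m) \<le> s (f n)")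
    case True
    then show ?thesis
      using f(1) that[of f] by (simp add: mono_def)
  next
    case False
    then have dec: "m \<le> n \<Longrightarrow> s (f n) \<le> s (f m)" for m n
      using f(2) unfolding monoseq_def by blast
    \<comment> \<open>The decreasing subsequence attains its minimum at some index \<open>N\<close>;
      from there on it can neither drop nor rise.\<close>
    obtain N where N: "\<And>n. s (f N) \<le> s (f n)"
      using ex_has_least_nat[of "\<lambda>_. True" 0 "\<lambda>n. s (f n)"] by auto
    have const: "s (f (N + n)) = s (f N)" for n
      using N[of "N + n"] dec[of N "N + n"] by simp
    have "strict_mono (\<lambda>n. f (N + n))"
      using f(1) by (simp add: strict_mono_def)
    then show ?thesis
      using that[of "\<lambda>n. f (N + n)"] const by (simp add: mono_def)
  qed
qed

text \<open>Treat the coordinates in \<open>A\<close> one at a time, refining the subsequence at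
  each stage; monotonicity already obtained in earlier coordinates survives refinement.\<close>

lemma finite_family_mono_subseq:
  fixes f :: "nat \<Rightarrow> 'a \<Rightarrow> nat"
  assumes "finite A"
  shows "\<exists>r :: nat \<Rightarrow> nat. strict_mono r \<and> (\<forall>a\<in>A. mono (\<lambda>n. f (r n) a))"
  using assms
proof (induction A rule: finite_induct)
  case empty
  show ?case by (rule exI[of _ id]) (simp add: strict_mono_def)
next
  case (insert b A)
  then obtain r :: "nat \<Rightarrow> nat" where r: "strict_mono r" "\<And>a. a \<in> A \<Longrightarrow> mono (\<lambda>n. f (r n) a)"
    by blast
  obtain q :: "nat \<Rightarrow> nat" where q: "strict_mono q" "mono ((\<lambda>n. f (r n) b) \<circ> q)"
    by (rule nat_seq_mono_subseq[of "\<lambda>n. f (r n) b"])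
  have "strict_mono (r \<circ> q)"
    using r(1) q(1) by (rule strict_mono_o)
  moreover have "mono (\<lambda>n. f ((r \<circ> q) n) a)" if "a \<in> insert b A" for a
    using that q r(2) strict_mono_mono[OF q(1)] by (auto simp: mono_def)
  ultimately show ?case by blast
qed

text \<open>A multiset over \<open>A\<close> is a vector of multiplicities indexed by
  \<open>A\<close>. Along a subsequence on which every multiplicity is non-decreasing, the first two
  terms are already comparable.\<close>

lemma dickson_multiset:
  fixes w :: "nat \<Rightarrow> 'a multiset"
  assumes "finite A" and "\<And>n. set_mset (w n) \<subseteq> A"
  obtains i j where "i < j" "w i \<subseteq># w j"
proof -
  obtain r :: "nat \<Rightarrow> nat" where r: "strict_mono r" "\<And>a. a \<in> A \<Longrightarrow> mono (\<lambda>n. count (w (r n)) a)"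
    using finite_family_mono_subseq[OF assms(1), of "\<lambda>n. count (w n)"] by blast
  have "count (w (r 0)) a \<le> count (w (r 1)) a" for a
  proof (cases "a \<in> A")
    case True
    then show ?thesis using r(2) by (simp add: mono_def)
  next
    case False
    then have "a \<notin># w (r 0)" using assms(2) by blast
    then show ?thesis by (simp add: not_in_iff)
  qed
  then have "w (r 0) \<subseteq># w (r 1)"
    by (simp add: subseteq_mset_def)
  moreover have "r 0 < r 1" using r(1) by (simp add: strict_mono_def)
  ultimately show ?thesis using that by blast
qed

section \<open>The preorder on words\<close>

context premonoid
begin

lemma le_refl: "x \<in> carrier H \<Longrightarrow> x \<preceq> x"
  using preord_refl by (simp add: reflp_on_def)

lemma le_trans:
  "\<lbrakk>x \<preceq> y; y \<preceq> z; x \<in> carrier H; y \<in> carrier H; z \<in> carrier H\<rbrakk> \<Longrightarrow> x \<preceq> z"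
  using preord_trans unfolding transp_on_def by blast

lemma word_le_trans:
  assumes "as \<in> lists (carrier H)" "bs \<in> lists (carrier H)" "cs \<in> lists (carrier H)"
    and "word_le H as bs" "word_le H bs cs"
  shows "word_le H as cs"
proof -
  from assms(4) obtain s where s: "s \<in> {..<length as} \<rightarrow> {..<length bs}"
    "inj_on s {..<length as}"
    "\<And>i. i < length as \<Longrightarrow> as ! i \<preceq> bs ! s i \<and> bs ! s i \<preceq> as ! i"
    unfolding word_le_def by blast
  from assms(5) obtain t where t: "t \<in> {..<length bs} \<rightarrow> {..<length cs}"
    "inj_on t {..<length bs}"
    "\<And>i. i < length bs \<Longrightarrow> bs ! i \<preceq> cs ! t i \<and> cs ! t i \<preceq> bs ! i"
    unfolding word_le_def by blast
  have car: "as \<in> lists (carrier H) \<Longrightarrow> i < length as \<Longrightarrow> as ! i \<in> carrier H" for as i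
    by auto
  have "inj_on (t \<circ> s) {..<length as}"
    using s(1,2) t(2) by (intro comp_inj_on) (auto intro: inj_on_subset)
  moreover have "as ! i \<preceq> cs ! t (s i) \<and> cs ! t (s i) \<preceq> as ! i" if i: "i < length as" for i
  proof -
    have si: "s i < length bs" using s(1) i by auto
    moreover from si have "t (s i) < length cs" using t(1) by auto
    ultimately show ?thesis
      using s(3)[OF i] t(3)[OF si] car assms(1-3) i by (meson le_trans)
  qed
  moreover have "t \<circ> s \<in> {..<length as} \<rightarrow> {..<length cs}"
    using s(1) t(1) by auto
  ultimately show ?thesis unfolding word_le_def by (intro exI[of _ "t \<circ> s"]) simp
qed

text \<open>Letters \<open>cs\<close> making up the difference turn \<open>as\<close> into a
  rearrangement of \<open>bs\<close>. The permutation, restricted to the positions of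
  \<open>as\<close>, is the required injection; it matches equal letters, so reflexivity
  suffices.\<close>

lemma word_le_if_subseteq_mset:
  assumes "bs \<in> lists (carrier H)" "mset as \<subseteq># mset bs"
  shows "word_le H as bs"
proof -
  obtain cs where "mset (as @ cs) = mset bs"
    using assms(2) by (metis ex_mset mset_append mset_subset_eq_exists_conv)
  then obtain p where p: "bij_betw p {..<length (as @ cs)} {..<length bs}"
    "\<And>i. i < length (as @ cs) \<Longrightarrow> (as @ cs) ! i = bs ! p i"
    using permutation_Ex_bij by blast
  have "p i < length bs" if "i < length as" for i
    using bij_betwE[OF p(1)] that by auto
  moreover have "inj_on p {..<length as}"
    using bij_betw_imp_inj_on[OF p(1)] by (rule inj_on_subset) auto
  moreover have "bs ! p i = as ! i" if "i < length as" for i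
    using p(2)[of i] that by (simp add: nth_append)
  ultimately show ?thesis
    using assms(1) unfolding word_le_def
    by (intro exI[of _ p]) (metis (no_types, lifting) Pi_I in_listsD le_refl lessThan_iff nth_mem)
qed

lemma word_le_refl: "as \<in> lists (carrier H) \<Longrightarrow> word_le H as as"
  by (simp add: word_le_if_subseteq_mset)

text \<open>An injection between index sets of equal size is a bijection, and its inverse would
  witness the reverse comparison. This is what makes a shortest factorization minimal.\<close>

lemma word_less_length:
  assumes "word_less H as bs"
  shows "length as < length bs"
proof -
  from assms obtain s where s: "s \<in> {..<length as} \<rightarrow> {..<length bs}"
    "inj_on s {..<length as}"
    "\<And>i. i < length as \<Longrightarrow> as ! i \<preceq> bs ! s i \<and> bs ! s i \<preceq> as ! i"
    unfolding word_less_def word_le_def by blast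
  have le: "length as \<le> length bs"
    using card_inj_on_le[OF s(2), of "{..<length bs}"] s(1) by auto
  moreover have "length as \<noteq> length bs"
  proof
    assume eq: "length as = length bs"
    let ?t = "inv_into {..<length as} s"
    have bij: "bij_betw s {..<length as} {..<length bs}"
      using s(1,2) eq by (simp add: bij_betw_def card_image card_subset_eq image_subset_iff_funcset)
    have "word_le H bs as"
      unfolding word_le_def
    proof (intro exI[of _ ?t] conjI allI impI)
      show "?t \<in> {..<length bs} \<rightarrow> {..<length as}"
        using bij_betwE[OF bij_betw_inv_into[OF bij]] by auto
      show "inj_on ?t {..<length bs}"
        using bij_betw_inv_into[OF bij] by (rule bij_betw_imp_inj_on)
      fix i assume "i < length bs"
      then have "?t i < length as" "s (?t i) = i"
        using bij_betwE[OF bij_betw_inv_into[OF bij]] bij_betw_inv_into_right[OF bij] by auto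
      then show "bs ! i \<preceq> as ! ?t i" "as ! ?t i \<preceq> bs ! i"
        using s(3)[of "?t i"] by auto
    qed
    then show False using assms by (simp add: word_less_def)
  qed
  ultimately show ?thesis by simp
qed

text \<open>Infinitely many classes would give a sequence of pairwise inequivalent minimal
  factorizations. Replacing each by an equivalent word over the finite alphabet \<open>A\<close>,
  Dickson's lemma finds two comparable ones, which minimality forces to be equivalent.\<close>

lemma finite_min_factorization_classes:
  assumes "finite A" "A \<subseteq> carrier H"
    and Z: "Z \<subseteq> min_factorizations H x"
    and eqv: "\<And>as. as \<in> Z \<Longrightarrow> \<exists>bs \<in> lists A. word_equiv H as bs"
  shows "finite (Z // {(as, bs) \<in> Z \<times> Z. word_equiv H as bs})"
proof (rule ccontr)
  define r where "r = {(as, bs) \<in> Z \<times> Z. word_equiv H as bs}"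
  have Z_car: "as \<in> lists (carrier H)" if "as \<in> Z" for as
    using that Z by (auto simp: min_factorizations_def factorizations_def pirreducibles_def
        pnonunits_def)
  have equiv: "equiv Z r"
  proof (rule equivI)
    show "r \<subseteq> Z \<times> Z" by (auto simp: r_def)
    show "refl_on Z r"
      using word_le_refl Z_car by (auto simp: r_def refl_on_def word_equiv_def)
    show "sym r"
      by (auto simp: r_def sym_def word_equiv_def)
    show "trans r"
    proof (rule transI)
      fix as bs cs assume "(as, bs) \<in> r" "(bs, cs) \<in> r"
      then show "(as, cs) \<in> r"
        using word_le_trans[of as bs cs] word_le_trans[of cs bs as] Z_car
        by (simp add: r_def word_equiv_def)
    qed
  qed
  assume "\<not> finite (Z // {(as, bs) \<in> Z \<times> Z. word_equiv H as bs})"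
  then obtain f :: "nat \<Rightarrow> 'a list set" where f: "inj f" "range f \<subseteq> Z // r"
    unfolding r_def[symmetric] using infinite_countable_subset by blast
  have "\<exists>as. as \<in> Z \<and> f n = r `` {as}" for n
    using range_subsetD[OF f(2), of n] by (rule quotientE) (intro exI conjI)
  then obtain g where g: "\<And>n. g n \<in> Z" "\<And>n. f n = r `` {g n}"
    by metis
  obtain w where w: "\<And>n. w n \<in> lists A" "\<And>n. word_equiv H (g n) (w n)"
    using eqv[OF g(1)] by metis
  \<comment> \<open>Nothing is lost by passing to multisets, since inclusion of multisets of letters
    already implies \<open>word_le\<close>.\<close>
  have "set_mset (mset (w n)) \<subseteq> A" for n
    using w(1)[of n] by auto
  then obtain i j where ij: "i < j" "mset (w i) \<subseteq># mset (w j)"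
    by (rule dickson_multiset[OF assms(1)])
  have w_car: "w n \<in> lists (carrier H)" for n
    using w(1) assms(2) by blast
  have "word_le H (w i) (w j)"
    using w_car ij(2) by (rule word_le_if_subseteq_mset)
  then have "word_le H (g i) (g j)"
    using w(2)[of i] w(2)[of j] w_car Z_car[OF g(1)]
    unfolding word_equiv_def by (meson word_le_trans)
  \<comment> \<open>Minimality of \<open>g j\<close> rules out strictness, so the comparison just
    found is an equivalence.\<close>
  moreover have "\<not> word_less H (g i) (g j)"
    using g(1)[of i] g(1)[of j] Z unfolding min_factorizations_def by blast
  ultimately have "(g i, g j) \<in> r"
    using g(1) by (simp add: r_def word_less_def word_equiv_def)
  then have "f i = f j"
    unfolding g(2) by (rule equiv_class_eq[OF equiv])
  then show False using f(1) ij(1) by (simp add: inj_eq)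
qed

end

section \<open>Words in a weakly positive monoid\<close>

lemma word_prod_Nil [simp]: "word_prod H [] = \<one>\<^bsub>H\<^esub>"
  and word_prod_Cons [simp]: "word_prod H (a # as) = a \<otimes>\<^bsub>H\<^esub> word_prod H as"
  by (simp_all add: word_prod_def)

context monoid
begin

lemma word_prod_closed [simp]:
  "set as \<subseteq> carrier G \<Longrightarrow> word_prod G as \<in> carrier G"
  by (induction as) auto

lemma word_prod_append:
  "\<lbrakk>set as \<subseteq> carrier G; set bs \<subseteq> carrier G\<rbrakk>
    \<Longrightarrow> word_prod G (as @ bs) = word_prod G as \<otimes> word_prod G bs"
  by (induction as) (auto simp: m_assoc)

section \<open>Two-sided divisors in a monoid\<close>

lemma divisors_closed: "y \<in> divisors G x \<Longrightarrow> y \<in> carrier G"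
  by (simp add: divisors_def)

lemma divisors_refl: "x \<in> carrier G \<Longrightarrow> x \<in> divisors G x"
  unfolding divisors_def by (auto intro!: bexI[of _ \<one>])

lemma divisors_trans:
  assumes "z \<in> divisors G y" "y \<in> divisors G x"
  shows "z \<in> divisors G x"
proof -
  obtain u v where uv: "u \<in> carrier G" "v \<in> carrier G" "y = u \<otimes> z \<otimes> v"
    and z: "z \<in> carrier G"
    using assms(1) unfolding divisors_def by blast
  obtain s t where st: "s \<in> carrier G" "t \<in> carrier G" "x = s \<otimes> y \<otimes> t"
    using assms(2) unfolding divisors_def by blast
  have "x = (s \<otimes> u) \<otimes> z \<otimes> (v \<otimes> t)"
    using uv z st by (simp add: m_assoc)
  then show ?thesis
    using uv st z unfolding divisors_def by blast
qed

lemma factors_in_divisors: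
  assumes "y \<in> carrier G" "z \<in> carrier G"
  shows "y \<in> divisors G (y \<otimes> z)" "z \<in> divisors G (y \<otimes> z)"
proof -
  have "y \<otimes> z = \<one> \<otimes> y \<otimes> z" "y \<otimes> z = y \<otimes> z \<otimes> \<one>"
    using assms by simp_all
  then show "y \<in> divisors G (y \<otimes> z)" "z \<in> divisors G (y \<otimes> z)"
    using assms unfolding divisors_def by blast+
qed

lemma letter_in_divisors:
  "\<lbrakk>set as \<subseteq> carrier G; a \<in> set as\<rbrakk> \<Longrightarrow> a \<in> divisors G (word_prod G as)"
proof (induction as)
  case (Cons b as)
  then show ?case
    using factors_in_divisors[of b "word_prod G as"] divisors_trans by auto
qed simp

end

context weakly_positive_monoid
begin

section \<open>Units, non-units and divisibility\<close>

lemma pnonunits_closed: "a \<in> pnonunits H \<Longrightarrow> a \<in> carrier H"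
  by (simp add: pnonunits_def)

lemma le_if_divisor: "y \<in> divisors H x \<Longrightarrow> y \<preceq> x"
  using le_mult by (auto simp: divisors_def)

text \<open>The other inequality is automatic: every element lies above \<open>\<one>\<close>,
  because \<open>\<one>\<close> divides it.\<close>

lemma punits_iff: "u \<in> punits H \<longleftrightarrow> u \<in> carrier H \<and> u \<preceq> \<one>"
  using le_mult[of \<one> u \<one>] by (auto simp: punits_def)

lemma punits_closed: "u \<in> punits H \<Longrightarrow> u \<in> carrier H"
  by (simp add: punits_def)

lemma one_punit: "\<one> \<in> punits H"
  by (simp add: punits_iff le_refl)

lemma punits_mult: "\<lbrakk>u \<in> punits H; v \<in> punits H\<rbrakk> \<Longrightarrow> u \<otimes> v \<in> punits H"
  using unit_mult_le[of \<one> u v] by (simp add: punits_iff)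

text \<open>A divisor lies below what it divides, hence below \<open>\<one>\<close> if that is a
  unit. Consequently a product with a non-unit factor is a non-unit.\<close>

lemma punit_if_divisor:
  "\<lbrakk>y \<in> divisors H u; u \<in> punits H\<rbrakk> \<Longrightarrow> y \<in> punits H"
  using le_if_divisor[of y u] le_trans[of y u \<one>]
  by (simp add: punits_iff divisors_closed)

lemma pnonunit_if_divisor:
  "\<lbrakk>y \<in> divisors H x; y \<in> pnonunits H; x \<in> carrier H\<rbrakk> \<Longrightarrow> x \<in> pnonunits H"
  using punit_if_divisor by (auto simp: pnonunits_def)

lemma pnonunit_mult:
  assumes "x \<in> carrier H" "y \<in> carrier H" "x \<in> pnonunits H \<or> y \<in> pnonunits H"
  shows "x \<otimes> y \<in> pnonunits H"
  using assms factors_in_divisors pnonunit_if_divisor by (meson m_closed)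

lemma pnonunit_word_prod:
  assumes "as \<noteq> []" "set as \<subseteq> pnonunits H"
  shows "word_prod H as \<in> pnonunits H"
proof (cases as)
  case (Cons a bs)
  then have "a \<in> pnonunits H" "set bs \<subseteq> carrier H"
    using assms pnonunits_closed by auto
  then show ?thesis
    using Cons pnonunit_mult[of a "word_prod H bs"] pnonunits_closed by simp
qed (use assms in simp)

lemma patoms_subset_pirreducibles: "patoms H \<subseteq> pirreducibles H"
  by (auto simp: patoms_def pirreducibles_def)

text \<open>Unit letters can be merged into a neighbouring non-unit letter, since \<open>S\<close>
  is stable under multiplication by units. Formally, the products \<open>W\<close> of non-empty
  words of non-unit generators, together with the units, form a submonoid containing
  \<open>S\<close>, hence exhaust the monoid.\<close>

lemma fgu_pnonunit_word:
  assumes S: "S \<subseteq> carrier H"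
    and left: "\<And>u s. \<lbrakk>u \<in> punits H; s \<in> S\<rbrakk> \<Longrightarrow> u \<otimes> s \<in> S"
    and right: "\<And>u s. \<lbrakk>u \<in> punits H; s \<in> S\<rbrakk> \<Longrightarrow> s \<otimes> u \<in> S"
    and gen: "generated_submonoid H S = carrier H"
    and y: "y \<in> pnonunits H"
  obtains gs where "gs \<noteq> []" "set gs \<subseteq> S \<inter> pnonunits H" "word_prod H gs = y"
proof -
  define W where "W = word_prod H ` {gs. gs \<noteq> [] \<and> set gs \<subseteq> S \<inter> pnonunits H}"
  have W_car: "W \<subseteq> carrier H"
    using S by (auto simp: W_def)
  have W_W: "x \<otimes> y \<in> W" if xy: "x \<in> W" "y \<in> W" for x y
  proof -
    obtain as bs where *: "as \<noteq> []" "set as \<subseteq> S \<inter> pnonunits H" "x = word_prod H as"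
      "set bs \<subseteq> S \<inter> pnonunits H" "y = word_prod H bs"
      using xy by (auto simp: W_def)
    then have "x \<otimes> y = word_prod H (as @ bs)"
      using S word_prod_append[of as bs] by auto
    then show ?thesis using * by (auto simp: W_def)
  qed
  \<comment> \<open>The unit is absorbed into the first letter, which remains a non-unit element of
    \<open>S\<close>.\<close>
  have U_W: "u \<otimes> x \<in> W" if ux: "u \<in> punits H" "x \<in> W" for u x
  proof -
    obtain a as where *: "a \<in> S" "a \<in> pnonunits H" "set as \<subseteq> S \<inter> pnonunits H"
      "x = word_prod H (a # as)"
      using ux(2) by (force simp: W_def neq_Nil_conv)
    moreover have "set as \<subseteq> carrier H" using * S by blast
    ultimately have "u \<otimes> x = word_prod H ((u \<otimes> a) # as)"
      using ux(1) by (simp add: punits_closed pnonunits_closed m_assoc)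
    moreover have "u \<otimes> a \<in> S \<inter> pnonunits H"
      using * ux(1) left pnonunit_mult by (simp add: punits_closed pnonunits_closed)
    ultimately show ?thesis
      using * unfolding W_def by (intro image_eqI[where x = "(u \<otimes> a) # as"]) auto
  qed
  \<comment> \<open>Here the last letter absorbs the unit.\<close>
  have W_U: "x \<otimes> u \<in> W" if ux: "u \<in> punits H" "x \<in> W" for u x
  proof -
    obtain gs where gs: "gs \<noteq> []" "set gs \<subseteq> S \<inter> pnonunits H" "x = word_prod H gs"
      using ux(2) by (auto simp: W_def)
    define a as where "a = last gs" and "as = butlast gs"
    have as_a: "gs = as @ [a]"
      using gs(1) by (simp add: a_def as_def)
    with gs have *: "a \<in> S" "a \<in> pnonunits H" "set as \<subseteq> S \<inter> pnonunits H"
      by auto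
    have as_car: "set as \<subseteq> carrier H" using * S by blast
    have "x \<otimes> u = word_prod H (as @ [a \<otimes> u])"
      using as_car ux(1) * as_a gs(3)
      by (simp add: word_prod_append punits_closed pnonunits_closed m_assoc)
    moreover have "a \<otimes> u \<in> S \<inter> pnonunits H"
      using * ux(1) right pnonunit_mult by (simp add: punits_closed pnonunits_closed)
    ultimately show ?thesis
      using * unfolding W_def by (intro image_eqI[where x = "as @ [a \<otimes> u]"]) auto
  qed
  have "submonoid (punits H \<union> W) H"
    using W_car one_punit by unfold_locales (auto intro: punits_mult W_W U_W W_U punits_closed)
  moreover have "S \<subseteq> punits H \<union> W"
  proof
    fix s assume s: "s \<in> S"
    show "s \<in> punits H \<union> W"
    proof (cases "s \<in> punits H")
      case False
      then show ?thesis
        using s S unfolding W_def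
        by (intro UnI2 image_eqI[where x = "[s]"]) (auto simp: pnonunits_def)
    qed simp
  qed
  ultimately have "carrier H \<subseteq> punits H \<union> W"
    unfolding gen[symmetric] generated_submonoid_def by (intro hull_minimal)
  then have "y \<in> W"
    using y by (auto simp: pnonunits_def)
  then show ?thesis
    using that by (auto simp: W_def)
qed

section \<open>Divisors of an element with finitely generated germ\<close>

lemma punits_submonoid:
  assumes "submonoid K H"
  shows "punits (H\<lparr>carrier := K\<rparr>) = punits H \<inter> K"
  using submonoid.subset[OF assms] by (auto simp: punits_def)

text \<open>Units of the submonoid are units of \<open>H\<close>, so both axioms restrict. This
  allows the results about generators to be applied inside a germ.\<close>

lemma weakly_positive_submonoid:
  assumes "submonoid K H"
  shows "weakly_positive_monoid (H\<lparr>carrier := K\<rparr>)"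
proof -
  note le = submonoid.subset[OF assms]
  have "premonoid (H\<lparr>carrier := K\<rparr>)"
    using submonoid.submonoid_is_monoid[OF assms monoid_axioms]
      reflp_on_subset[OF preord_refl le] transp_on_subset[OF preord_trans le]
    by (simp add: premonoid_def premonoid_axioms_def)
  then show ?thesis
    using le unit_mult_le le_mult
    by (auto simp: weakly_positive_monoid_def weakly_positive_monoid_axioms_def
        punits_submonoid[OF assms] subset_iff)
qed

lemma set_mult_punits_iff:
  "g \<in> punits H <#> A <#> punits H \<longleftrightarrow>
    (\<exists>u \<in> punits H. \<exists>a \<in> A. \<exists>v \<in> punits H. g = u \<otimes> a \<otimes> v)"
  by (auto simp: set_mult_def)

lemma set_mult_punits_closed:
  "A \<subseteq> carrier H \<Longrightarrow> punits H <#> A <#> punits H \<subseteq> carrier H"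
  using punits_closed by (auto simp: set_mult_punits_iff subset_iff)

lemma set_mult_punits_absorb:
  assumes "A \<subseteq> carrier H" "u \<in> punits H" "s \<in> punits H <#> A <#> punits H"
  shows "u \<otimes> s \<in> punits H <#> A <#> punits H" "s \<otimes> u \<in> punits H <#> A <#> punits H"
proof -
  obtain t a v where s: "t \<in> punits H" "a \<in> A" "v \<in> punits H" "s = t \<otimes> a \<otimes> v"
    using assms(3) by (auto simp: set_mult_punits_iff)
  then have "u \<otimes> s = (u \<otimes> t) \<otimes> a \<otimes> v" "s \<otimes> u = t \<otimes> a \<otimes> (v \<otimes> u)"
    using assms(1,2) punits_closed by (auto simp: m_assoc)
  then show "u \<otimes> s \<in> punits H <#> A <#> punits H" "s \<otimes> u \<in> punits H <#> A <#> punits H"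
    unfolding set_mult_punits_iff using s punits_mult assms(2) by blast+
qed

lemma fgu_generators:
  assumes "fgu H"
  obtains A where "finite A" "A \<subseteq> carrier H"
    "\<And>y. y \<in> pnonunits H \<Longrightarrow> \<exists>gs. gs \<noteq> [] \<and> word_prod H gs = y \<and>
      set gs \<subseteq> (punits H <#> A <#> punits H) \<inter> pnonunits H"
proof -
  obtain A where A: "finite A" "A \<subseteq> carrier H"
    "generated_submonoid H (punits H <#> A <#> punits H) = carrier H"
    using assms unfolding fgu_def by blast
  show ?thesis
    using A(1,2) fgu_pnonunit_word[OF set_mult_punits_closed[OF A(2)]
        set_mult_punits_absorb(1)[OF A(2)] set_mult_punits_absorb(2)[OF A(2)] A(3)]
    by (intro that[of A]) metis+
qed

text \<open>The statement for f.g.u. monoids is applied inside the germ and carried back to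
  \<open>H\<close>: products agree, non-units of the germ are the non-units of \<open>H\<close> in
  it, and passing to the units of \<open>H\<close> can only enlarge the generating set. One finite
  \<open>A\<close> serves all divisors of \<open>x\<close>.\<close>

lemma germ_generators:
  assumes "fgu (germ H x)"
  obtains A where "finite A" "A \<subseteq> carrier H"
    "\<And>y. \<lbrakk>y \<in> divisors H x; y \<in> pnonunits H\<rbrakk> \<Longrightarrow> \<exists>gs. gs \<noteq> [] \<and> word_prod H gs = y \<and>
      set gs \<subseteq> (punits H <#> A <#> punits H) \<inter> pnonunits H"
proof -
  define K where "K = generated_submonoid H (divisors H x)"
  have sub: "submonoid K H"
    unfolding K_def by (rule submonoid_generated_submonoid) (auto simp: divisors_def)
  note le = submonoid.subset[OF sub]
  let ?K = "H\<lparr>carrier := K\<rparr>"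
  interpret K: weakly_positive_monoid ?K
    by (rule weakly_positive_submonoid[OF sub])
  have "fgu ?K" using assms by (simp add: germ_def K_def)
  then obtain A where A: "finite A" "A \<subseteq> K"
    "\<And>y. y \<in> pnonunits ?K \<Longrightarrow> \<exists>gs. gs \<noteq> [] \<and> word_prod ?K gs = y \<and>
      set gs \<subseteq> (punits ?K <#>\<^bsub>?K\<^esub> A <#>\<^bsub>?K\<^esub> punits ?K) \<inter> pnonunits ?K"
    by (rule K.fgu_generators) auto
  have nonunits: "pnonunits ?K = pnonunits H \<inter> K"
    using le by (auto simp: pnonunits_def punits_submonoid[OF sub])
  have prod: "word_prod ?K gs = word_prod H gs" for gs
    by (simp add: word_prod_def)
  have orbit: "punits ?K <#>\<^bsub>?K\<^esub> A <#>\<^bsub>?K\<^esub> punits ?K \<subseteq> punits H <#> A <#> punits H"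
    using mono_set_mult[of "punits H \<inter> K" "punits H"]
    by (auto simp: punits_submonoid[OF sub] set_mult_def)
  have "divisors H x \<subseteq> K"
    unfolding K_def generated_submonoid_def by (rule hull_subset)
  then show ?thesis
    using A(1,2) le A(3) orbit unfolding nonunits prod
    by (intro that[of A]) blast+
qed

text \<open>The two axioms of weak positivity give the two inequalities. Thus the possibly infinite
  set of elements \<open>u \<otimes> a \<otimes> v\<close> has only finitely many values up to
  equivalence when \<open>A\<close> is finite.\<close>

lemma set_mult_punits_equiv:
  assumes "A \<subseteq> carrier H" "g \<in> punits H <#> A <#> punits H"
  obtains a u v where "a \<in> A" "u \<in> punits H" "v \<in> punits H" "g = u \<otimes> a \<otimes> v" "g \<preceq> a" "a \<preceq> g"
proof -
  obtain u a v where "u \<in> punits H" "a \<in> A" "v \<in> punits H" "g = u \<otimes> a \<otimes> v"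
    using assms(2) by (auto simp: set_mult_punits_iff)
  moreover from this have "g \<preceq> a" "a \<preceq> g"
    using assms(1) unit_mult_le le_mult punits_closed by blast+
  ultimately show ?thesis using that by blast
qed

text \<open>An atom cannot be a product of two or more non-unit letters, so it equals a single
  \<open>u \<otimes> a \<otimes> v\<close>, which is equivalent to \<open>a\<close>. Being an atom
  passes to \<open>a\<close>, since a splitting of \<open>a\<close> would split the atom.\<close>

lemma patom_equiv_generator:
  assumes A: "A \<subseteq> carrier H"
    and gs: "gs \<noteq> []" "set gs \<subseteq> (punits H <#> A <#> punits H) \<inter> pnonunits H"
    and atom: "word_prod H gs \<in> patoms H"
  shows "\<exists>a \<in> A \<inter> patoms H. word_prod H gs \<preceq> a \<and> a \<preceq> word_prod H gs"
proof -
  obtain g hs where gs_eq: "gs = g # hs" using gs(1) by (cases gs) auto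
  have g: "g \<in> punits H <#> A <#> punits H" "g \<in> pnonunits H" "set hs \<subseteq> pnonunits H"
    using gs(2) gs_eq by auto
  have "hs = []"
    using atom pnonunit_word_prod[of hs] g unfolding gs_eq patoms_def by auto
  then have prod: "word_prod H gs = g"
    using g(2) pnonunits_closed gs_eq by simp
  obtain a u v where a: "a \<in> A" "u \<in> punits H" "v \<in> punits H" "g = u \<otimes> a \<otimes> v" "g \<preceq> a" "a \<preceq> g"
    by (rule set_mult_punits_equiv[OF A g(1)])
  have a_car: "a \<in> carrier H" using A a(1) by blast
  \<comment> \<open>If \<open>a\<close> were a unit, so would be
    \<open>g = u \<otimes> a \<otimes> v\<close>.\<close>
  have "a \<notin> punits H"
    using g(2) a(2-4) punits_mult by (auto simp: pnonunits_def)
  then have "a \<in> pnonunits H" using a_car by (simp add: pnonunits_def)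
  moreover have False if yz: "y \<in> pnonunits H" "z \<in> pnonunits H" "a = y \<otimes> z" for y z
  proof -
    \<comment> \<open>Each outer unit joins the adjacent factor, giving a forbidden splitting of the
      atom \<open>g\<close>.\<close>
    have "g = (u \<otimes> y) \<otimes> (z \<otimes> v)"
      using a(2-4) yz by (simp add: punits_closed pnonunits_closed m_assoc)
    moreover have "u \<otimes> y \<in> pnonunits H" "z \<otimes> v \<in> pnonunits H"
      using a(2,3) yz by (simp_all add: punits_closed pnonunits_closed pnonunit_mult)
    ultimately show False
      using atom prod unfolding patoms_def by blast
  qed
  ultimately have "a \<in> patoms H" unfolding patoms_def by blast
  then show ?thesis using a(1,5,6) prod by blast
qed

section \<open>The loft property\<close>

lemma word_equiv_letterwise:
  assumes "\<And>a. a \<in> set as \<Longrightarrow> \<exists>b \<in> B. a \<preceq> b \<and> b \<preceq> a"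
  shows "\<exists>bs \<in> lists B. word_equiv H as bs"
proof -
  obtain f where f: "\<And>a. a \<in> set as \<Longrightarrow> f a \<in> B \<and> a \<preceq> f a \<and> f a \<preceq> a"
    using assms by metis
  have "word_equiv H as (map f as)"
    unfolding word_equiv_def word_le_def using f by (intro conjI exI[of _ id]) auto
  then show ?thesis using f by (intro bexI[of _ "map f as"]) auto
qed

text \<open>A letter of a factorization of \<open>x\<close> is an atom by \<open>irr\<close> and
  divides \<open>x\<close>, so it is equivalent to an atom in the finite set \<open>A\<close>
  attached to the germ. Replacing letters one by one keeps the word in its class.\<close>

lemma loft_at:
  assumes irr: "pirreducibles H \<subseteq> patoms H" and "fgu (germ H x)"
  obtains A where "finite A" "A \<subseteq> pirreducibles H"
    "\<And>as. as \<in> factorizations H x \<Longrightarrow> \<exists>bs \<in> lists A. word_equiv H as bs"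
proof -
  obtain A where A: "finite A" "A \<subseteq> carrier H"
    "\<And>y. \<lbrakk>y \<in> divisors H x; y \<in> pnonunits H\<rbrakk> \<Longrightarrow> \<exists>gs. gs \<noteq> [] \<and> word_prod H gs = y \<and>
      set gs \<subseteq> (punits H <#> A <#> punits H) \<inter> pnonunits H"
    using germ_generators[OF assms(2)] by blast
  show ?thesis
  proof
    show "finite (A \<inter> patoms H)" using A(1) by simp
    show "A \<inter> patoms H \<subseteq> pirreducibles H" using patoms_subset_pirreducibles by blast
    fix as assume as: "as \<in> factorizations H x"
    show "\<exists>bs \<in> lists (A \<inter> patoms H). word_equiv H as bs"
    proof (rule word_equiv_letterwise)
      fix a assume a: "a \<in> set as"
      then have atom: "a \<in> patoms H"
        using as irr by (auto simp: factorizations_def)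
      have "set as \<subseteq> carrier H"
        using as by (auto simp: factorizations_def pirreducibles_def pnonunits_def)
      then have "a \<in> divisors H x"
        using letter_in_divisors[OF _ a] as by (simp add: factorizations_def)
      then obtain gs where gs: "gs \<noteq> []" "word_prod H gs = a"
        "set gs \<subseteq> (punits H <#> A <#> punits H) \<inter> pnonunits H"
        using A(3)[of a] atom unfolding patoms_def by blast
      show "\<exists>b \<in> A \<inter> patoms H. a \<preceq> b \<and> b \<preceq> a"
        using patom_equiv_generator[OF A(2) gs(1,3)] atom gs(2) by simp
    qed
  qed
qed

section \<open>Existence of factorizations\<close>

lemma factorizations_word_prod:
  assumes "\<And>g. g \<in> set gs \<Longrightarrow> factorizations H g \<noteq> {}"
  shows "factorizations H (word_prod H gs) \<noteq> {}"
  using assms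
proof (induction gs)
  case Nil
  then show ?case by (auto simp: factorizations_def intro: exI[of _ "[]"])
next
  case (Cons g gs)
  obtain as bs where *: "as \<in> factorizations H g" "bs \<in> factorizations H (word_prod H gs)"
    using Cons by fastforce
  then have "set as \<subseteq> carrier H" "set bs \<subseteq> carrier H"
    by (auto simp: factorizations_def pirreducibles_def pnonunits_def)
  then have "as @ bs \<in> factorizations H (word_prod H (g # gs))"
    using * by (auto simp: factorizations_def word_prod_append)
  then show ?case by blast
qed

text \<open>Splitting terminates because the number of elements of \<open>A\<close> strictly below
  the current factor drops; this measure supplies the induction that \<open>\<preceq>\<close> itself
  might not.\<close>

lemma factorization_exists:
  assumes "fgu (germ H x)" "x \<in> pnonunits H"
  shows "factorizations H x \<noteq> {}"
proof -
  obtain A where A: "finite A" "A \<subseteq> carrier H"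
    "\<And>y. \<lbrakk>y \<in> divisors H x; y \<in> pnonunits H\<rbrakk> \<Longrightarrow> \<exists>gs. gs \<noteq> [] \<and> word_prod H gs = y \<and>
      set gs \<subseteq> (punits H <#> A <#> punits H) \<inter> pnonunits H"
    using germ_generators[OF assms(1)] by blast
  let ?G = "(punits H <#> A <#> punits H) \<inter> pnonunits H"
  \<comment> \<open>A divisor of \<open>x\<close> need not lie in \<open>?G\<close>, but it is a
    product of elements of \<open>?G\<close> that divide it and so lie below it; it suffices to
    factor those.\<close>
  have step: "factorizations H y \<noteq> {}"
    if y: "y \<in> divisors H x" "y \<in> pnonunits H"
      and IH: "\<And>g. \<lbrakk>g \<in> ?G; g \<in> divisors H x; g \<preceq> y\<rbrakk> \<Longrightarrow> factorizations H g \<noteq> {}" for y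
  proof -
    obtain gs where gs: "word_prod H gs = y" "set gs \<subseteq> ?G"
      using A(3)[OF y] by blast
    then have "g \<in> divisors H y" if "g \<in> set gs" for g
      using letter_in_divisors[OF _ that] pnonunits_closed by auto
    then show ?thesis
      using factorizations_word_prod[of gs] gs IH y(1) divisors_trans le_if_divisor
      by (metis subsetD)
  qed
  have "factorizations H g \<noteq> {}" if "g \<in> ?G" "g \<in> divisors H x" for g
    using that
  proof (induction "card {a \<in> A. a \<prec> g}" arbitrary: g rule: less_induct)
    case less
    have g: "g \<in> pnonunits H" "g \<in> carrier H" using less.prems pnonunits_closed by auto
    show ?case
    proof (cases "g \<in> pirreducibles H")
      case True
      then have "[g] \<in> factorizations H g" using g by (simp add: factorizations_def)
      then show ?thesis by blast
    next
      case False
      then obtain y z where yz: "y \<in> pnonunits H" "z \<in> pnonunits H" "y \<prec> g" "z \<prec> g" "g = y \<otimes> z"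
        using g unfolding pirreducibles_def by blast
      have fact: "factorizations H y \<noteq> {}"
        if y: "y \<in> pnonunits H" "y \<prec> g" "y \<in> divisors H g" for y
      proof (rule step)
        show "y \<in> divisors H x" using y(3) less.prems(2) by (rule divisors_trans)
        show "y \<in> pnonunits H" by fact
        fix h assume h: "h \<in> ?G" "h \<in> divisors H x" "h \<preceq> y"
        have car: "h \<in> carrier H" "y \<in> carrier H"
          using h y pnonunits_closed by auto
        have hg: "h \<prec> g"
          using h(3) y(2) car g(2) unfolding strict_preord_def by (meson le_trans)
        \<comment> \<open>The generator \<open>a\<close> equivalent to \<open>h\<close> makes the
          measure drop: it is strictly below \<open>g\<close> but not strictly below
          \<open>h\<close>.\<close>
        obtain a where a: "a \<in> A" "h \<preceq> a" "a \<preceq> h"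
          using set_mult_punits_equiv[OF A(2)] h(1) by blast
        have a_car: "a \<in> carrier H" using A(2) a(1) by blast
        have "b \<prec> g" if "b \<in> A" "b \<prec> h" for b
          using that hg car g(2) A(2) unfolding strict_preord_def by (meson le_trans subsetD)
        moreover have "a \<prec> g" "\<not> a \<prec> h"
          using a hg car a_car g(2) unfolding strict_preord_def by (meson le_trans)+
        ultimately have "{b \<in> A. b \<prec> h} \<subset> {b \<in> A. b \<prec> g}"
          using a(1) by blast
        then show "factorizations H h \<noteq> {}"
          by (intro less.hyps h(1,2) psubset_card_mono) (simp_all add: A(1))
      qed
      have "factorizations H y \<noteq> {}" "factorizations H z \<noteq> {}"
        using fact yz factors_in_divisors pnonunits_closed by metis+
      then show ?thesis
        using factorizations_word_prod[of "[y, z]"] yz pnonunits_closed by auto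
    qed
  qed
  then show ?thesis
    using step[of x] assms(2) divisors_refl pnonunits_closed by blast
qed

text \<open>A factorization of least length is minimal, because a strictly smaller word is strictly
  shorter.\<close>

lemma min_factorization_exists:
  assumes "factorizations H x \<noteq> {}"
  shows "min_factorizations H x \<noteq> {}"
proof -
  obtain as where "as \<in> factorizations H x"
    "\<And>bs. bs \<in> factorizations H x \<Longrightarrow> length as \<le> length bs"
    using assms ex_has_least_nat[of "\<lambda>as. as \<in> factorizations H x" _ length] by blast
  then have "as \<in> min_factorizations H x"
    unfolding min_factorizations_def using word_less_length by fastforce
  then show ?thesis by blast
qed

end

theorem theorem4p12:
  fixes H :: "('a, 'b) premonoid_scheme"
  assumes "weakly_positive_monoid H"
    and "weakly_lfgu H"
    and "pirreducibles H \<subseteq> patoms H"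
  shows "loft H \<and> FmF_atomic H"
proof
  interpret weakly_positive_monoid H by fact
  have germ: "fgu (germ H x)" if "x \<in> pnonunits H" for x
    using assms(2) that by (simp add: weakly_lfgu_def)
  show "loft H"
    unfolding loft_def
  proof
    fix x assume "x \<in> pnonunits H"
    then show "\<exists>A. finite A \<and> A \<subseteq> pirreducibles H \<and>
        (\<forall>as \<in> factorizations H x. \<exists>bs \<in> lists A. word_equiv H as bs)"
      using loft_at[OF assms(3) germ] by metis
  qed
  show "FmF_atomic H"
    unfolding FmF_atomic_def Let_def
  proof (intro ballI conjI)
    fix x assume x: "x \<in> pnonunits H"
    \<comment> \<open>Factorizations are words in irreducibles, all of which are atoms here, so
      every minimal factorization is atomic.\<close>
    have eq: "min_atomic_factorizations H x = min_factorizations H x"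
      using assms(3) by (auto simp: min_atomic_factorizations_def min_factorizations_def
          factorizations_def)
    show "min_atomic_factorizations H x \<noteq> {}"
      unfolding eq using min_factorization_exists factorization_exists germ x by blast
    obtain A where A: "finite A" "A \<subseteq> pirreducibles H"
      "\<And>as. as \<in> factorizations H x \<Longrightarrow> \<exists>bs \<in> lists A. word_equiv H as bs"
      using loft_at[OF assms(3) germ[OF x]] by blast
    moreover have "A \<subseteq> carrier H"
      using A(2) by (auto simp: pirreducibles_def pnonunits_def)
    ultimately show "finite (min_atomic_factorizations H x //
        {(as, bs) \<in> min_atomic_factorizations H x \<times> min_atomic_factorizations H x.
          word_equiv H as bs})"
      unfolding eq
      by (intro finite_min_factorization_classes[of A]) (auto simp: min_factorizations_def)
  qed
qed

end
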